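(* Let $\Lambda$ be a group, $\Gamma<\Lambda$ an amenable subgroup, $C\ge1$, $0<\varepsilon<(10C)^{-1}$, $\mathcal H$ a Hilbert space, and $\pi:\Lambda\to B(\mathcal H)$ a map such that $\pi(e)=\mathrm{Id}$ and, for every $x\in\Gamma$ and $h\in\Lambda$, $\pi(x)\in U(\mathcal H)$, $\|\pi(h)\|\le C$ and $\|\pi(xh)-\pi(x)\pi(h)\|\le\varepsilon$. Then there is a map $\sigma:\Lambda\to B(\mathcal H)$ such that for every $x\in\Gamma$ and $h\in\Lambda$: $\|\sigma(h)-\pi(h)\|\le\varepsilon+120C\varepsilon^2$, $\sigma(x)\in U(\mathcal H)$, $\|\sigma(h)\|\le C$, and $\sigma(xh)=\sigma(x)\sigma(h)$.
   Context: $B(\mathcal H)$ denotes the bounded operators on $\mathcal H$ with operator norm $\|\cdot\|$, and $U(\mathcal H)$ the unitary group. *)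

theory Defs
  imports "HOL-Analysis.Analysis" "HOL-Algebra.Group"
begin

class complex_vector_space = real_normed_vector +
  fixes scaleC :: "complex \<Rightarrow> 'a \<Rightarrow> 'a"
  assumes scaleC_add_right: "scaleC a (x + y) = scaleC a x + scaleC a y"
    and scaleC_add_left: "scaleC (a + b) x = scaleC a x + scaleC b x"
    and scaleC_scaleC: "scaleC a (scaleC b x) = scaleC (a * b) x"
    and scaleC_one: "scaleC 1 x = x"
    and scaleC_of_real: "scaleC (complex_of_real r) x = scaleR r x"
    and norm_scaleC: "norm (scaleC a x) = cmod a * norm x"

class complex_inner_space = complex_vector_space +
  fixes cinner :: "'a \<Rightarrow> 'a \<Rightarrow> complex"
  assumes cinner_commute: "cinner x y = cnj (cinner y x)"
    and cinner_add_left: "cinner (x + y) z = cinner x z + cinner y z"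
    and cinner_scaleC_left: "cinner (scaleC a x) y = cnj a * cinner x y"
    and cinner_self_nonneg: "Im (cinner x x) = 0 \<and> Re (cinner x x) \<ge> 0"
    and cinner_self_eq_zero: "cinner x x = 0 \<longleftrightarrow> x = 0"
    and norm_eq_sqrt_cinner: "norm x = sqrt (Re (cinner x x))"

class complex_hilbert_space = complex_inner_space + complete_space

definition bounded_op :: "('a::complex_vector_space \<Rightarrow> 'a) \<Rightarrow> bool" where
  "bounded_op T \<longleftrightarrow> bounded_linear T \<and> (\<forall>c x. T (scaleC c x) = scaleC c (T x))"

definition unitary_op :: "('a::complex_inner_space \<Rightarrow> 'a) \<Rightarrow> bool" where
  "unitary_op U \<longleftrightarrow> bounded_op U \<and>
     (\<exists>V. bounded_op V \<and> (\<forall>x y. cinner (U x) y = cinner x (V y)) \<and>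
          V \<circ> U = id \<and> U \<circ> V = id)"

text \<open>A subgroup H of G (viewed as a discrete group) is amenable if there is a left-invariant
  mean on the bounded real functions on H: a linear, positive, normalised functional which is
  invariant under left translation by elements of H. Functions are on the ambient type; only
  their values on H matter.\<close>
definition amenable_subgroup :: "('a, 'b) monoid_scheme \<Rightarrow> 'a set \<Rightarrow> bool" where
  "amenable_subgroup G H \<longleftrightarrow> subgroup H G \<and>
    (\<exists>m :: ('a \<Rightarrow> real) \<Rightarrow> real.
      (\<forall>f g. (\<forall>x\<in>H. f x = g x) \<longrightarrow> m f = m g) \<and>
      (\<forall>f g. bounded (f ` H) \<longrightarrow> bounded (g ` H) \<longrightarrow> m (\<lambda>x. f x + g x) = m f + m g) \<and>
      (\<forall>c f. bounded (f ` H) \<longrightarrow> m (\<lambda>x. c * f x) = c * m f) \<and>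
      (\<forall>f. bounded (f ` H) \<longrightarrow> (\<forall>x\<in>H. 0 \<le> f x) \<longrightarrow> 0 \<le> m f) \<and>
      m (\<lambda>x. 1) = 1 \<and>
      (\<forall>f y. bounded (f ` H) \<longrightarrow> y \<in> H \<longrightarrow> m (\<lambda>x. f (y \<otimes>\<^bsub>G\<^esub> x)) = m f))"

end

theory Submission
  imports Defs
begin

text \<open>
  Kazhdan's averaging argument. Replacing \<open>\<pi>\<close> by \<open>h \<mapsto> \<integral> \<pi>(x)\<^sup>* \<pi>(x h) dx\<close>, the weak integral being
  taken against a right-invariant mean on \<open>\<Gamma>\<close>, moves \<open>\<pi>\<close> by at most \<open>\<epsilon>\<close> and makes the
  multiplicativity defect \<open>O(\<epsilon>\<^sup>2)\<close>, as the first-order errors cancel. On \<open>\<Gamma>\<close> the average intertwines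
  inverses with adjoints, so it is within \<open>O(\<epsilon>\<^sup>2)\<close> of being unitary and a Newton--Schulz iteration
  replaces it by a unitary; this leaves a defect of \<open>8 C \<epsilon>\<^sup>2 < 4 \<epsilon> / 5\<close>. Repeating the procedure gives
  a Cauchy sequence, whose limit is \<open>\<sigma>\<close>.
\<close>

section \<open>Real inner product and Riesz representation\<close>

instance complex_hilbert_space \<subseteq> banach ..

text \<open>The mean is real-valued, so weak integrals and adjoints are treated with the real part
  alone. Complex linearity is tracked separately, and together the two recover the complex adjoint
  relation.\<close>

definition rinner :: "'a::complex_inner_space \<Rightarrow> 'a \<Rightarrow> real" where
  "rinner x y = Re (cinner x y)"

lemma rinner_commute: "rinner x y = rinner y x"
  unfolding rinner_def by (subst cinner_commute) simp

lemma rinner_add_left: "rinner (x + y) z = rinner x z + rinner y z"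
  by (simp add: rinner_def cinner_add_left)

lemma rinner_scaleR_left: "rinner (r *\<^sub>R x) y = r * rinner x y"
  by (simp add: rinner_def cinner_scaleC_left flip: scaleC_of_real)

lemma rinner_add_right: "rinner z (x + y) = rinner z x + rinner z y"
  by (metis rinner_add_left rinner_commute)

lemma rinner_scaleR_right: "rinner y (r *\<^sub>R x) = r * rinner y x"
  by (metis rinner_scaleR_left rinner_commute)

lemma rinner_self: "rinner x x = (norm x)\<^sup>2"
  using cinner_self_nonneg[of x] by (simp add: rinner_def norm_eq_sqrt_cinner)

lemma norm_add_sq: "(norm (x + y :: 'a::complex_inner_space))\<^sup>2 = (norm x)\<^sup>2 + 2 * rinner x y + (norm y)\<^sup>2"
  unfolding rinner_self[symmetric]
  by (simp add: rinner_add_left rinner_add_right rinner_commute)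

text \<open>The class already makes \<open>norm\<close> a norm, so Cauchy-Schwarz can be read off
  from the triangle inequality by squaring and expanding.\<close>

lemma rinner_le_norm: "rinner x y \<le> norm x * norm y"
proof -
  have "(norm (x + y))\<^sup>2 \<le> (norm x + norm y)\<^sup>2"
    by (intro power_mono norm_triangle_ineq norm_ge_zero)
  then show ?thesis
    unfolding norm_add_sq by (simp add: power2_sum)
qed

lemma rinner_minus_left: "rinner (- x) y = - rinner x y"
  using rinner_scaleR_left[of "-1" x y] by simp

lemma abs_rinner_le_norm: "\<bar>rinner x y\<bar> \<le> norm x * norm y"
  using rinner_le_norm[of x y] rinner_le_norm[of "- x" y] by (simp add: rinner_minus_left)

lemma bounded_bilinear_rinner: "bounded_bilinear rinner"
  by (rule bounded_bilinear.intro)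
    (auto simp: rinner_add_left rinner_add_right rinner_scaleR_left rinner_scaleR_right
      intro!: exI[of _ 1] abs_rinner_le_norm)

interpretation rinner: bounded_bilinear rinner
  by (rule bounded_bilinear_rinner)

lemma rinner_ext:
  assumes "\<And>v. rinner x v = rinner y v"
  shows "x = y"
proof -
  have "rinner (x - y) (x - y) = 0"
    unfolding rinner.diff_left assms by simp
  then show ?thesis by (simp add: rinner_self)
qed

lemma bounded_linear_scaleC: "bounded_linear (scaleC c :: 'a::complex_vector_space \<Rightarrow> 'a)"
proof (rule bounded_linear_intro)
  show "scaleC c (r *\<^sub>R x) = r *\<^sub>R scaleC c x" for r and x :: 'a
    by (simp add: scaleC_scaleC mult.commute flip: scaleC_of_real)
  show "norm (scaleC c x) \<le> norm x * cmod c" for x :: 'a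
    by (simp add: norm_scaleC)
qed (rule scaleC_add_right)

text \<open>The representing vector is the minimiser of \<open>w \<mapsto> \<parallel>w\<parallel>\<^sup>2 - 2 l w\<close>.\<close>
lemma riesz_representation:
  fixes l :: "'a::complex_hilbert_space \<Rightarrow> real"
  assumes "bounded_linear l"
  obtains w where "\<And>v. l v = rinner w v"
proof -
  interpret l: bounded_linear l by fact
  define q where "q w = (norm w)\<^sup>2 - 2 * l w" for w
  obtain B where B: "\<And>x. norm (l x) \<le> norm x * B"
    using l.bounded by blast
  have q_lower: "- B\<^sup>2 \<le> q w" for w
  proof -
    have "l w \<le> norm w * B" using B[of w] by (simp add: abs_le_iff)
    moreover have "0 \<le> (norm w - B)\<^sup>2" by simp
    ultimately show ?thesis by (simp add: q_def power2_diff algebra_simps)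
  qed
  have bdd: "bdd_below (range q)"
    using q_lower by (intro bdd_belowI) auto
  define d where "d = Inf (range q)"
  have d_le: "d \<le> q w" for w
    unfolding d_def using bdd by (intro cInf_lower) auto
  \<comment> \<open>Along a line \<open>q\<close> is a quadratic polynomial. The values
    \<open>t = 1\<close> and \<open>t = 1/2\<close> give the midpoint estimate below; another choice
    of \<open>t\<close> shows at the end that a minimiser is stationary.\<close>
  have q_add: "q (w + t *\<^sub>R v) = q w + 2 * t * (rinner w v - l v) + t\<^sup>2 * (norm v)\<^sup>2" for w t v
    by (simp add: q_def norm_add_sq l.add l.scaleR rinner.scaleR_right power_mult_distrib algebra_simps)
  \<comment> \<open>A form of the parallelogram law: as \<open>q\<close> at the midpoint is at least
    \<open>d\<close>, near-minimisers lie close together and a minimising sequence is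
    Cauchy.\<close>
  have near: "(norm (v - w))\<^sup>2 \<le> 2 * (q v + q w - 2 * d)" for v w
  proof -
    have v: "w + 1 *\<^sub>R (v - w) = v" by simp
    have "q (w + (1/2) *\<^sub>R (v - w)) = (q v + q w) / 2 - (norm (v - w))\<^sup>2 / 4"
      using q_add[of w 1 "v - w", unfolded v] q_add[of w "1/2" "v - w"] by (simp add: power_divide)
    with d_le[of "w + (1/2) *\<^sub>R (v - w)"] show ?thesis by (simp add: field_simps)
  qed
  have "\<exists>w. q w < d + inverse (real (Suc n))" for n
  proof -
    have "\<exists>y\<in>range q. y < d + inverse (real (Suc n))"
      unfolding d_def by (rule cInf_lessD) auto
    then show ?thesis by auto
  qed
  then obtain W where W: "\<And>n. q (W n) < d + inverse (real (Suc n))"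
    by metis
  have "Cauchy W"
  proof (rule metric_CauchyI)
    fix e :: real assume "e > 0"
    then obtain N where N: "inverse (real (Suc N)) < e\<^sup>2 / 4"
      using reals_Archimedean[of "e\<^sup>2 / 4"] by auto
    have q_le: "q (W n) < d + e\<^sup>2 / 4" if "n \<ge> N" for n
    proof -
      have "inverse (real (Suc n)) \<le> inverse (real (Suc N))"
        using that by (intro le_imp_inverse_le) auto
      then show ?thesis using W[of n] N by linarith
    qed
    have "dist (W m) (W n) < e" if "m \<ge> N" "n \<ge> N" for m n
    proof -
      have "(norm (W m - W n))\<^sup>2 < e\<^sup>2"
        using near[of "W m" "W n"] q_le[OF that(1)] q_le[OF that(2)] by simp
      then show ?thesis
        using \<open>e > 0\<close> by (simp add: dist_norm power2_less_imp_less)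
    qed
    then show "\<exists>M. \<forall>m\<ge>M. \<forall>n\<ge>M. dist (W m) (W n) < e" by blast
  qed
  then obtain w where w: "W \<longlonglongrightarrow> w"
    using Cauchy_convergent convergent_def by blast
  have "q w \<le> d"
  proof (rule LIMSEQ_le)
    show "(\<lambda>n. q (W n)) \<longlonglongrightarrow> q w"
      unfolding q_def by (intro tendsto_intros w l.tendsto)
    show "(\<lambda>n. d + inverse (real (Suc n))) \<longlonglongrightarrow> d"
      using LIMSEQ_inverse_real_of_nat_add by blast
    show "\<exists>N. \<forall>n\<ge>N. q (W n) \<le> d + inverse (real (Suc n))"
      using W less_imp_le by blast
  qed
  have "l v = rinner w v" for v
  proof (rule ccontr)
    define a where "a = rinner w v - l v"
    assume "l v \<noteq> rinner w v"
    then have a: "a \<noteq> 0" by (simp add: a_def)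
    define p where "p = 1 + (norm v)\<^sup>2"
    have p: "p > 0" by (simp add: p_def add_pos_nonneg)
    \<comment> \<open>This \<open>t\<close> minimises \<open>2 * t * a + t\<^sup>2 * p\<close>; the
      1 added in \<open>p\<close> keeps the divisor positive even for \<open>v = 0\<close>.\<close>
    define t where "t = - a / p"
    have "0 \<le> 2 * t * a + t\<^sup>2 * (norm v)\<^sup>2"
      using q_add[of w t v] d_le[of "w + t *\<^sub>R v"] \<open>q w \<le> d\<close> by (simp add: a_def)
    also have "\<dots> \<le> 2 * t * a + t\<^sup>2 * p"
      by (simp add: p_def mult_left_mono)
    also have "\<dots> = - a\<^sup>2 / p"
      using p by (simp add: t_def field_simps power2_eq_square)
    also have "\<dots> < 0" using a p by (simp add: divide_neg_pos)
    finally show False by simp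
  qed
  then show thesis by (rule that)
qed

section \<open>Finitely additive means and weak integrals of vectors\<close>

locale bounded_mean =
  fixes X :: "'g set" and m :: "('g \<Rightarrow> real) \<Rightarrow> real"
  assumes mean_cong: "\<And>f g. (\<And>x. x \<in> X \<Longrightarrow> f x = g x) \<Longrightarrow> m f = m g"
    and mean_add: "\<And>f g. bounded (f ` X) \<Longrightarrow> bounded (g ` X) \<Longrightarrow> m (\<lambda>x. f x + g x) = m f + m g"
    and mean_mult: "\<And>c f. bounded (f ` X) \<Longrightarrow> m (\<lambda>x. c * f x) = c * m f"
    and mean_nonneg: "\<And>f. bounded (f ` X) \<Longrightarrow> (\<And>x. x \<in> X \<Longrightarrow> 0 \<le> f x) \<Longrightarrow> 0 \<le> m f"
    and mean_one: "m (\<lambda>x. 1) = 1"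
begin

lemma mean_const: "m (\<lambda>x. c) = c"
  using mean_mult[of "\<lambda>x. 1" c] by (simp add: mean_one image_constant_conv)

lemma mean_le:
  assumes "bounded (f ` X)" "\<And>x. x \<in> X \<Longrightarrow> f x \<le> B"
  shows "m f \<le> B"
proof -
  have b: "bounded ((\<lambda>x. (-1) * f x) ` X)"
    using assms(1) bounded_uminus[of "f ` X"] by (simp add: image_image)
  have "m (\<lambda>x. B + (-1) * f x) = m (\<lambda>x. B) + m (\<lambda>x. (-1) * f x)"
    by (rule mean_add[OF _ b]) (simp add: image_constant_conv)
  then have "m (\<lambda>x. B + (-1) * f x) = B + (-1) * m f"
    by (simp only: mean_mult[OF assms(1)] mean_const)
  moreover have "0 \<le> m (\<lambda>x. B + (-1) * f x)"
  proof (rule mean_nonneg)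
    show "bounded ((\<lambda>x. B + (-1) * f x) ` X)"
      using b by (intro bounded_plus_comp) (auto simp: image_constant_conv)
  qed (use assms in auto)
  ultimately show ?thesis by simp
qed

lemma mean_abs_le:
  assumes "\<And>x. x \<in> X \<Longrightarrow> \<bar>f x\<bar> \<le> B"
  shows "\<bar>m f\<bar> \<le> B"
proof -
  have b: "bounded (f ` X)"
    using assms by (intro boundedI[of _ B]) auto
  have "m f \<le> B" using assms by (intro mean_le[OF b]) (auto simp: abs_le_iff)
  moreover have "m (\<lambda>x. (-1) * f x) \<le> B"
  proof (rule mean_le)
    show "bounded ((\<lambda>x. (-1) * f x) ` X)"
      using assms by (intro boundedI[of _ B]) auto
  qed (use assms in \<open>auto simp: abs_le_iff\<close>)
  ultimately show ?thesis using mean_mult[OF b, of "-1"] by (simp add: abs_le_iff)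
qed

text \<open>The weak integral of \<open>f\<close> against \<open>m\<close>. It is meaningful for
  \<open>f\<close> bounded on \<open>X\<close>, where Riesz supplies the vector and
  \<open>rinner_ext\<close> its uniqueness.\<close>

definition vmean :: "('g \<Rightarrow> 'a::complex_hilbert_space) \<Rightarrow> 'a" where
  "vmean f = (SOME w. \<forall>v. rinner w v = m (\<lambda>x. rinner (f x) v))"

lemma bounded_linear_comp_image:
  "bounded_linear l \<Longrightarrow> bounded (f ` X) \<Longrightarrow> bounded ((\<lambda>x. l (f x)) ` X)"
  using bounded_linear_image[of "f ` X" l] by (simp add: image_image)

lemma rinner_vmean:
  fixes f :: "'g \<Rightarrow> 'a::complex_hilbert_space"
  assumes "bounded (f ` X)"
  shows "rinner (vmean f) v = m (\<lambda>x. rinner (f x) v)"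
proof -
  obtain B where B: "\<And>x. x \<in> X \<Longrightarrow> norm (f x) \<le> B"
    using assms by (auto simp: bounded_iff)
  have bd: "bounded ((\<lambda>x. rinner (f x) v) ` X)" for v
    by (rule bounded_linear_comp_image[OF rinner.bounded_linear_left assms])
  have "bounded_linear (\<lambda>v. m (\<lambda>x. rinner (f x) v))"
  proof (rule bounded_linear_intro)
    show "norm (m (\<lambda>x. rinner (f x) v)) \<le> norm v * B" for v
      unfolding real_norm_def
    proof (rule mean_abs_le)
      fix x assume "x \<in> X"
      have "\<bar>rinner (f x) v\<bar> \<le> norm (f x) * norm v" by (rule abs_rinner_le_norm)
      also have "\<dots> \<le> B * norm v" using B[OF \<open>x \<in> X\<close>] by (simp add: mult_right_mono)
      finally show "\<bar>rinner (f x) v\<bar> \<le> norm v * B" by (simp add: mult.commute)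
    qed
  qed (simp_all add: rinner.add_right rinner.scaleR_right mean_add mean_mult bd)
  then have "\<exists>w. \<forall>v. rinner w v = m (\<lambda>x. rinner (f x) v)"
    by (metis riesz_representation)
  then have "\<forall>v. rinner (vmean f) v = m (\<lambda>x. rinner (f x) v)"
    unfolding vmean_def by (rule someI_ex)
  then show ?thesis by simp
qed

lemma vmean_cong: "(\<And>x. x \<in> X \<Longrightarrow> f x = g x) \<Longrightarrow> vmean f = vmean g"
  unfolding vmean_def by (simp cong: mean_cong)

lemma vmean_const: "vmean (\<lambda>x. c) = c"
  by (rule rinner_ext) (simp add: rinner_vmean mean_const image_constant_conv)

lemma vmean_add:
  assumes "bounded (f ` X)" "bounded (g ` X)"
  shows "vmean (\<lambda>x. f x + g x) = vmean f + vmean g"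
proof (rule rinner_ext)
  show "rinner (vmean (\<lambda>x. f x + g x)) v = rinner (vmean f + vmean g) v" for v
    using assms bounded_linear_comp_image[OF rinner.bounded_linear_left[of v]]
    by (simp add: rinner_vmean bounded_plus_comp rinner.add_left mean_add)
qed

text \<open>The functional \<open>u \<mapsto> rinner (l u) v\<close> is represented by some
  \<open>w\<close>, the adjoint of \<open>l\<close> applied to \<open>v\<close>; testing against
  \<open>w\<close> moves \<open>l\<close> across the weak integral.\<close>

lemma vmean_linear:
  fixes l :: "'a::complex_hilbert_space \<Rightarrow> 'b::complex_hilbert_space"
  assumes "bounded_linear l" "bounded (f ` X)"
  shows "l (vmean f) = vmean (\<lambda>x. l (f x))"
proof (rule rinner_ext)
  fix v
  obtain w where w: "\<And>u. rinner (l u) v = rinner w u"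
    using riesz_representation[OF bounded_linear_compose[OF rinner.bounded_linear_left[of v] assms(1)]]
    by metis
  have "rinner (l (vmean f)) v = rinner (vmean f) w"
    by (metis w rinner_commute)
  also have "\<dots> = m (\<lambda>x. rinner (l (f x)) v)"
    by (simp add: rinner_vmean[OF assms(2)] w rinner_commute[of w])
  also have "\<dots> = rinner (vmean (\<lambda>x. l (f x))) v"
    by (simp add: rinner_vmean bounded_linear_comp_image[OF assms])
  finally show "rinner (l (vmean f)) v = rinner (vmean (\<lambda>x. l (f x))) v" .
qed

text \<open>Testing the weak integral against itself bounds the square of its norm by
  \<open>B\<close> times its norm; dividing by the norm is why the zero vector is split off.\<close>

lemma norm_vmean_le:
  assumes "\<And>x. x \<in> X \<Longrightarrow> norm (f x) \<le> B" "0 \<le> B"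
  shows "norm (vmean f) \<le> B"
proof (cases "vmean f = 0")
  case False
  have b: "bounded (f ` X)"
    using assms by (intro boundedI[of _ B]) auto
  have "(norm (vmean f))\<^sup>2 = m (\<lambda>x. rinner (f x) (vmean f))"
    by (simp add: rinner_vmean[OF b] flip: rinner_self)
  also have "\<dots> \<le> B * norm (vmean f)"
  proof (rule mean_le)
    show "bounded ((\<lambda>x. rinner (f x) (vmean f)) ` X)"
      by (rule bounded_linear_comp_image[OF rinner.bounded_linear_left b])
    show "rinner (f x) (vmean f) \<le> B * norm (vmean f)" if "x \<in> X" for x
      using rinner_le_norm[of "f x" "vmean f"] mult_right_mono[OF assms(1)[OF that] norm_ge_zero[of "vmean f"]]
      by linarith
  qed
  finally show ?thesis using False by (simp add: power2_eq_square)
qed (use assms in simp)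

section \<open>Averages of operators\<close>

definition omean :: "('g \<Rightarrow> 'a::complex_hilbert_space \<Rightarrow>\<^sub>L 'a) \<Rightarrow> 'a \<Rightarrow>\<^sub>L 'a" where
  "omean F = Blinfun (\<lambda>v. vmean (\<lambda>x. blinfun_apply (F x) v))"

lemma bounded_apply: "bounded (F ` X) \<Longrightarrow> bounded ((\<lambda>x. blinfun_apply (F x) v) ` X)"
  by (rule bounded_linear_comp_image[OF blinfun.bounded_linear_left])

lemma omean_apply:
  assumes "bounded (F ` X)"
  shows "blinfun_apply (omean F) v = vmean (\<lambda>x. blinfun_apply (F x) v)"
proof -
  obtain B where B: "\<And>x. x \<in> X \<Longrightarrow> norm (F x) \<le> B"
    using assms by (auto simp: bounded_iff)
  have "bounded_linear (\<lambda>v. vmean (\<lambda>x. blinfun_apply (F x) v))"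
  proof (rule bounded_linear_intro)
    show "norm (vmean (\<lambda>x. blinfun_apply (F x) v)) \<le> norm v * \<bar>B\<bar>" for v
    proof (rule norm_vmean_le)
      fix x assume "x \<in> X"
      have "norm (F x v) \<le> norm (F x) * norm v" by (rule norm_blinfun)
      also have "\<dots> \<le> \<bar>B\<bar> * norm v"
        using B[OF \<open>x \<in> X\<close>] by (intro mult_right_mono) auto
      finally show "norm (F x v) \<le> norm v * \<bar>B\<bar>" by (simp add: mult.commute)
    qed simp
    show "vmean (\<lambda>x. F x (r *\<^sub>R v)) = r *\<^sub>R vmean (\<lambda>x. F x v)" for r v
      by (simp add: vmean_linear[OF bounded_linear_scaleR_right] bounded_apply assms blinfun.scaleR_right)
  qed (simp add: blinfun.add_right vmean_add bounded_apply assms)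
  then show ?thesis
    by (simp add: omean_def bounded_linear_Blinfun_apply)
qed

lemma rinner_omean:
  "bounded (F ` X) \<Longrightarrow> rinner (omean F v) w = m (\<lambda>x. rinner (F x v) w)"
  by (simp add: omean_apply rinner_vmean bounded_apply)

lemma omean_cong: "(\<And>x. x \<in> X \<Longrightarrow> F x = K x) \<Longrightarrow> omean F = omean K"
  unfolding omean_def by (intro arg_cong[where f=Blinfun] ext vmean_cong) simp

lemma omean_const: "omean (\<lambda>x. A) = A"
  by (rule blinfun_eqI) (simp add: omean_apply vmean_const image_constant_conv)

lemma omean_add:
  assumes "bounded (F ` X)" "bounded (K ` X)"
  shows "omean (\<lambda>x. F x + K x) = omean F + omean K"
  by (rule blinfun_eqI)
    (simp add: assms omean_apply vmean_add bounded_apply bounded_plus_comp blinfun.add_left)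

lemma omean_compose_left:
  assumes "bounded (F ` X)"
  shows "omean (\<lambda>x. A o\<^sub>L F x) = A o\<^sub>L omean F"
proof (rule blinfun_eqI)
  fix v
  have "bounded ((\<lambda>x. A o\<^sub>L F x) ` X)"
    by (rule bounded_linear_comp_image[OF bounded_bilinear.bounded_linear_right[OF bounded_bilinear_blinfun_compose] assms])
  then show "omean (\<lambda>x. A o\<^sub>L F x) v = (A o\<^sub>L omean F) v"
    by (simp add: omean_apply assms vmean_linear blinfun.bounded_linear_right bounded_apply)
qed

lemma omean_compose_right:
  assumes "bounded (F ` X)"
  shows "omean (\<lambda>x. F x o\<^sub>L A) = omean F o\<^sub>L A"
proof (rule blinfun_eqI)
  fix v
  have "bounded ((\<lambda>x. F x o\<^sub>L A) ` X)"
    by (rule bounded_linear_comp_image[OF bounded_bilinear.bounded_linear_left[OF bounded_bilinear_blinfun_compose] assms])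
  then show "omean (\<lambda>x. F x o\<^sub>L A) v = (omean F o\<^sub>L A) v"
    by (simp add: omean_apply assms)
qed

lemma norm_omean_le:
  assumes "\<And>x. x \<in> X \<Longrightarrow> norm (F x) \<le> B" "0 \<le> B"
  shows "norm (omean F) \<le> B"
proof (rule norm_blinfun_bound)
  fix v
  have b: "bounded (F ` X)"
    using assms by (intro boundedI[of _ B]) auto
  show "norm (omean F v) \<le> B * norm v"
    unfolding omean_apply[OF b]
  proof (rule norm_vmean_le)
    show "norm (F x v) \<le> B * norm v" if "x \<in> X" for x
      using norm_blinfun[of "F x" v] mult_right_mono[OF assms(1)[OF that] norm_ge_zero[of v]] by linarith
  qed (use assms in simp)
qed fact

text \<open>The mean of a product differs from the product of the means by a covariance, which is of
  second order in the oscillation of the factors.\<close>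
lemma norm_omean_compose_le:
  fixes A B :: "'g \<Rightarrow> 'b::complex_hilbert_space \<Rightarrow>\<^sub>L 'b"
  assumes A: "\<And>x. x \<in> X \<Longrightarrow> norm (A x - a) \<le> e" and B: "\<And>x. x \<in> X \<Longrightarrow> norm (B x - b) \<le> e"
    and e: "0 \<le> e"
  shows "norm (omean (\<lambda>x. A x o\<^sub>L B x) - (omean A o\<^sub>L omean B)) \<le> 2 * e\<^sup>2"
proof -
  define A' where "A' x = A x - a" for x
  define B' where "B' x = B x - b" for x
  have bA: "bounded (A' ` X)" and bB: "bounded (B' ` X)"
    using A B by (auto simp: A'_def B'_def intro!: boundedI[of _ e])
  have prod_le: "norm (P o\<^sub>L Q) \<le> e\<^sup>2" if "norm P \<le> e" "norm Q \<le> e" for P Q :: "'b \<Rightarrow>\<^sub>L 'b"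
    using norm_blinfun_compose[of P Q] mult_mono[OF that e norm_ge_zero] by (simp add: power2_eq_square)
  have le: "norm (A' x o\<^sub>L B' x) \<le> e\<^sup>2" if "x \<in> X" for x
    using A[OF that] B[OF that] by (intro prod_le) (simp_all add: A'_def B'_def)
  have bAB: "bounded ((\<lambda>x. A' x o\<^sub>L B' x) ` X)"
    using le by (auto intro!: boundedI[of _ "e\<^sup>2"])
  have bc: "bounded ((\<lambda>x. c) ` X)" for c :: "'b \<Rightarrow>\<^sub>L 'b"
    by (simp add: image_constant_conv)
  interpret c: bounded_bilinear "(o\<^sub>L) :: ('b \<Rightarrow>\<^sub>L 'b) \<Rightarrow> _ \<Rightarrow> 'b \<Rightarrow>\<^sub>L 'b"
    by (rule bounded_bilinear_blinfun_compose)
  have baB: "bounded ((\<lambda>x. a o\<^sub>L B' x) ` X)" and bAb: "bounded ((\<lambda>x. A' x o\<^sub>L b) ` X)"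
    using bounded_linear_comp_image[OF c.bounded_linear_right bB]
      bounded_linear_comp_image[OF c.bounded_linear_left bA] by auto
  have "omean A = omean (\<lambda>x. A' x + a)" by (simp add: A'_def)
  then have mA: "omean A = omean A' + a" by (simp add: omean_add bA bc omean_const)
  have "omean B = omean (\<lambda>x. B' x + b)" by (simp add: B'_def)
  then have mB: "omean B = omean B' + b" by (simp add: omean_add bB bc omean_const)
  \<comment> \<open>Expanding around \<open>a\<close> and \<open>b\<close>, the terms constant or
    linear in the deviations average to exactly those in the product of the averages. Two quadratic
    terms survive, each at most \<open>e\<^sup>2\<close>.\<close>
  have "(\<lambda>x. A x o\<^sub>L B x) = (\<lambda>x. (A' x o\<^sub>L B' x) + ((a o\<^sub>L B' x) + ((A' x o\<^sub>L b) + (a o\<^sub>L b))))"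
    by (simp add: A'_def B'_def c.diff_left c.diff_right fun_eq_iff)
  then have "omean (\<lambda>x. A x o\<^sub>L B x) =
      omean (\<lambda>x. A' x o\<^sub>L B' x) + ((a o\<^sub>L omean B') + ((omean A' o\<^sub>L b) + (a o\<^sub>L b)))"
    by (simp add: omean_add omean_compose_left omean_compose_right omean_const
        bAB baB bAb bc bA bB bounded_plus_comp)
  then have "omean (\<lambda>x. A x o\<^sub>L B x) - (omean A o\<^sub>L omean B) =
      omean (\<lambda>x. A' x o\<^sub>L B' x) - (omean A' o\<^sub>L omean B')"
    by (simp add: mA mB c.add_left c.add_right)
  moreover have "norm (omean (\<lambda>x. A' x o\<^sub>L B' x)) \<le> e\<^sup>2"
    by (rule norm_omean_le) (use le in auto)
  moreover have "norm (omean A' o\<^sub>L omean B') \<le> e\<^sup>2"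
    using A B e by (intro prod_le norm_omean_le) (auto simp: A'_def B'_def)
  ultimately show ?thesis
    using norm_triangle_ineq4[of "omean (\<lambda>x. A' x o\<^sub>L B' x)" "omean A' o\<^sub>L omean B'"] by simp
qed

end


section \<open>Limits of operators; adjoint and unitary pairs\<close>

lemma geometric_steps_limit:
  fixes x :: "nat \<Rightarrow> 'a::banach"
  assumes step: "\<And>n. norm (x (Suc n) - x n) \<le> a * r ^ n" and r: "0 \<le> r" "r < 1"
  obtains l where "x \<longlonglongrightarrow> l" "norm (l - x 0) \<le> a / (1 - r)"
proof -
  have geo: "summable (\<lambda>n. a * r ^ n)"
    using r by (intro summable_mult summable_geometric) simp
  have sm: "summable (\<lambda>n. x (Suc n) - x n)"
    by (rule summable_comparison_test'[OF geo, of 0]) (rule step)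
  define s where "s = (\<Sum>n. x (Suc n) - x n)"
  have "(\<lambda>n. \<Sum>k<n. x (Suc k) - x k) \<longlonglongrightarrow> s"
    unfolding s_def by (rule summable_LIMSEQ[OF sm])
  then have "(\<lambda>n. x 0 + (x n - x 0)) \<longlonglongrightarrow> x 0 + s"
    by (intro tendsto_intros) (simp add: sum_lessThan_telescope)
  moreover have "norm s \<le> (\<Sum>n. a * r ^ n)"
    unfolding s_def by (rule norm_suminf_le[OF step geo])
  moreover have "(\<Sum>n. a * r ^ n) = a / (1 - r)"
    using r by (simp add: suminf_mult summable_geometric suminf_geometric)
  ultimately show thesis using that[of "x 0 + s"] by simp
qed

text \<open>Operators of type \<open>'a \<Rightarrow>\<^sub>L 'a\<close> are linear over the reals
  only, so complex homogeneity is a predicate that has to be carried through averages, Newton steps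
  and limits.\<close>

definition clinear_op :: "('a::complex_vector_space \<Rightarrow>\<^sub>L 'a) \<Rightarrow> bool" where
  "clinear_op T \<longleftrightarrow> (\<forall>c v. T (scaleC c v) = scaleC c (T v))"

text \<open>The adjoint is carried along as a second operator instead of being constructed: for the
  averages it is explicit, namely the average at the inverse element.\<close>

definition adjoint_pair :: "('a::complex_inner_space \<Rightarrow>\<^sub>L 'a) \<Rightarrow> ('a \<Rightarrow>\<^sub>L 'a) \<Rightarrow> bool" where
  "adjoint_pair T S \<longleftrightarrow> (\<forall>v w. rinner (T v) w = rinner v (S w))"

definition unitary_pair :: "('a::complex_inner_space \<Rightarrow>\<^sub>L 'a) \<Rightarrow> ('a \<Rightarrow>\<^sub>L 'a) \<Rightarrow> bool" where
  "unitary_pair U V \<longleftrightarrow> clinear_op U \<and> clinear_op V \<and> adjoint_pair U V \<and>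
     V o\<^sub>L U = id_blinfun \<and> U o\<^sub>L V = id_blinfun"

lemma adjoint_pair_sym: "adjoint_pair T S \<Longrightarrow> adjoint_pair S T"
  unfolding adjoint_pair_def by (metis rinner_commute)

lemma unitary_pair_sym: "unitary_pair U V \<Longrightarrow> unitary_pair V U"
  unfolding unitary_pair_def using adjoint_pair_sym by blast

lemma blinfun_compose_tendsto:
  "(A \<longlongrightarrow> a) F \<Longrightarrow> (B \<longlongrightarrow> b) F \<Longrightarrow> ((\<lambda>n. A n o\<^sub>L B n) \<longlongrightarrow> (a o\<^sub>L b)) F"
  by (rule bounded_bilinear.tendsto[OF bounded_bilinear_blinfun_compose])

lemma blinfun_apply_tendsto: "(A \<longlongrightarrow> a) F \<Longrightarrow> ((\<lambda>n. blinfun_apply (A n) v) \<longlongrightarrow> blinfun_apply a v) F"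
  by (intro tendsto_intros)

lemma clinear_op_limit:
  assumes "A \<longlonglongrightarrow> a" "\<And>n. clinear_op (A n)"
  shows "clinear_op a"
  unfolding clinear_op_def
proof (intro allI)
  fix c v
  have "(\<lambda>n. A n (scaleC c v)) \<longlonglongrightarrow> a (scaleC c v)"
    by (rule blinfun_apply_tendsto[OF assms(1)])
  moreover have "(\<lambda>n. A n (scaleC c v)) \<longlonglongrightarrow> scaleC c (a v)"
    using bounded_linear.tendsto[OF bounded_linear_scaleC blinfun_apply_tendsto[OF assms(1)], of c v] assms(2)
    by (simp add: clinear_op_def)
  ultimately show "a (scaleC c v) = scaleC c (a v)"
    by (rule LIMSEQ_unique)
qed

lemma adjoint_pair_limit:
  assumes "A \<longlonglongrightarrow> a" "B \<longlonglongrightarrow> b" "\<And>n. adjoint_pair (A n) (B n)"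
  shows "adjoint_pair a b"
  unfolding adjoint_pair_def
proof (intro allI)
  fix v w
  have "(\<lambda>n. rinner (A n v) w) \<longlonglongrightarrow> rinner (a v) w"
    by (intro rinner.tendsto blinfun_apply_tendsto assms tendsto_const)
  moreover have "(\<lambda>n. rinner v (B n w)) \<longlonglongrightarrow> rinner v (b w)"
    by (intro rinner.tendsto blinfun_apply_tendsto assms tendsto_const)
  ultimately show "rinner (a v) w = rinner v (b w)"
    using assms(3) by (simp add: adjoint_pair_def LIMSEQ_unique)
qed

lemma norm_unitary_pair_le:
  assumes "unitary_pair U V"
  shows "norm U \<le> 1"
proof (rule norm_blinfun_bound)
  fix v
  have "V (U v) = v"
    using assms unfolding unitary_pair_def by (metis blinfun_apply_blinfun_compose id_blinfun.rep_eq)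
  then have "rinner (U v) (U v) = rinner v v"
    using assms by (simp add: unitary_pair_def adjoint_pair_def)
  then show "norm (U v) \<le> 1 * norm v" by (simp add: rinner_self)
qed simp

lemma norm_unitary_compose_le:
  assumes "unitary_pair U V"
  shows "norm (U o\<^sub>L A) \<le> norm A"
  using norm_blinfun_compose[of U A] mult_right_mono[OF norm_unitary_pair_le[OF assms] norm_ge_zero[of A]]
  by simp

lemma norm_blinfun_compose_mono:
  "norm A \<le> a \<Longrightarrow> norm B \<le> b \<Longrightarrow> norm (A o\<^sub>L B) \<le> a * b"
  by (meson mult_mono norm_blinfun_compose norm_ge_zero order_trans)

text \<open>Inverting unitaries does not increase distances, since
  \<open>B i - B j = B i o\<^sub>L ((A j - A i) o\<^sub>L B j)\<close> with contractions on the
  outside. Hence the inverses converge too, and the defining identities pass to the limit.\<close>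

lemma unitary_pair_limit:
  fixes A :: "nat \<Rightarrow> 'a::complex_hilbert_space \<Rightarrow>\<^sub>L 'a"
  assumes lim: "A \<longlonglongrightarrow> a" and A: "\<And>n. \<exists>V. unitary_pair (A n) V"
  shows "\<exists>V. unitary_pair a V"
proof -
  obtain B where B: "\<And>n. unitary_pair (A n) (B n)" using A by metis
  note BD = B[unfolded unitary_pair_def]
  have diff: "norm (B i - B j) \<le> norm (A i - A j)" for i j
  proof -
    have "B i (A i v) = v" "A j (B j v) = v" for v
      using BD by (metis blinfun_apply_blinfun_compose id_blinfun.rep_eq)+
    then have "B i - B j = B i o\<^sub>L ((A j - A i) o\<^sub>L B j)"
      by (intro blinfun_eqI) (simp add: blinfun.bilinear_simps)
    moreover have "norm (B i o\<^sub>L ((A j - A i) o\<^sub>L B j)) \<le> 1 * (norm (A j - A i) * 1)"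
      by (intro norm_blinfun_compose_mono order_refl norm_unitary_pair_le[OF unitary_pair_sym[OF B]])
    ultimately show ?thesis by (simp add: norm_minus_commute)
  qed
  have "Cauchy A" using lim by (rule LIMSEQ_imp_Cauchy)
  then have "Cauchy B"
    unfolding Cauchy_def dist_norm using diff by (meson le_less_trans)
  then obtain b where b: "B \<longlonglongrightarrow> b"
    using Cauchy_convergent convergent_def by blast
  have "(\<lambda>n. B n o\<^sub>L A n) \<longlonglongrightarrow> (b o\<^sub>L a)" "(\<lambda>n. A n o\<^sub>L B n) \<longlonglongrightarrow> (a o\<^sub>L b)"
    by (intro blinfun_compose_tendsto lim b)+
  then have "b o\<^sub>L a = id_blinfun" "a o\<^sub>L b = id_blinfun"
    using BD by (simp_all add: LIMSEQ_const_iff)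
  then have "unitary_pair a b"
    unfolding unitary_pair_def
    using clinear_op_limit[OF lim] clinear_op_limit[OF b] adjoint_pair_limit[OF lim b] BD by blast
  then show ?thesis ..
qed

section \<open>Newton--Schulz iteration towards a unitary\<close>

text \<open>One step of the Newton--Schulz iteration for the polar decomposition of \<open>T\<close>, where \<open>S\<close> is
  the adjoint of \<open>T\<close>.\<close>
definition newton :: "('a::real_normed_vector \<Rightarrow>\<^sub>L 'a) \<Rightarrow> ('a \<Rightarrow>\<^sub>L 'a) \<Rightarrow> ('a \<Rightarrow>\<^sub>L 'a)" where
  "newton T S = (3/2) *\<^sub>R T - (1/2) *\<^sub>R (T o\<^sub>L (S o\<^sub>L T))"

text \<open>The displacement is controlled by the defect of \<open>S\<close> as a left inverse of
  \<open>T\<close>, so fast shrinking defects make the iterates converge.\<close>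

lemma newton_diff: "newton T S - T = (1/2) *\<^sub>R (T o\<^sub>L (id_blinfun - (S o\<^sub>L T)))"
proof (rule blinfun_eqI)
  fix v
  have "(3/2) *\<^sub>R T v = (1/2) *\<^sub>R T v + T v"
    using scaleR_left_distrib[of "1/2" 1 "T v"] by simp
  then show "(newton T S - T) v = ((1/2) *\<^sub>R (T o\<^sub>L (id_blinfun - (S o\<^sub>L T)))) v"
    by (simp add: newton_def blinfun.bilinear_simps scaleR_right_diff_distrib)
qed

text \<open>Everything is a polynomial in \<open>x = S T\<close>, so this is the scalar identity
  \<open>1 - x (3 - x)\<^sup>2 / 4 = 3 h\<^sup>2 / 4 + h\<^sup>3 / 4\<close> with
  \<open>h = 1 - x\<close>. The missing linear term in \<open>h\<close> is the source of quadratic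
  convergence.\<close>

lemma newton_defect:
  fixes T S :: "'a::real_normed_vector \<Rightarrow>\<^sub>L 'a"
  defines "H \<equiv> id_blinfun - (S o\<^sub>L T)"
  shows "id_blinfun - (newton S T o\<^sub>L newton T S) = (3/4) *\<^sub>R (H o\<^sub>L H) + (1/4) *\<^sub>R (H o\<^sub>L (H o\<^sub>L H))"
proof (rule blinfun_eqI)
  fix v
  define p q r where "p = S (T v)" and "q = S (T p)" and "r = S (T q)"
  have "newton S T (newton T S v) = (9/4) *\<^sub>R p - (3/2) *\<^sub>R q + (1/4) *\<^sub>R r"
  proof -
    have "newton S T (newton T S v) = (3/2) *\<^sub>R (3/2) *\<^sub>R p - (3/2) *\<^sub>R (1/2) *\<^sub>R q
        - ((1/2) *\<^sub>R (3/2) *\<^sub>R q - (1/2) *\<^sub>R (1/2) *\<^sub>R r)"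
      by (simp add: newton_def blinfun.bilinear_simps p_def q_def r_def scaleR_right_diff_distrib)
    moreover have "(3/2) *\<^sub>R q = (3/4) *\<^sub>R q + (3/4) *\<^sub>R q"
      by (simp flip: scaleR_left_distrib)
    ultimately show ?thesis by simp
  qed
  moreover have "(H o\<^sub>L H) v = v - 2 *\<^sub>R p + q"
    by (simp add: H_def blinfun.bilinear_simps p_def q_def r_def scaleR_2)
  moreover have "(H o\<^sub>L (H o\<^sub>L H)) v = v - 3 *\<^sub>R p + 3 *\<^sub>R q - r"
  proof -
    have "3 *\<^sub>R x = x + x + x" for x :: 'a
      using scaleR_left_distrib[of 2 1 x] by (simp add: scaleR_2)
    then show ?thesis
      by (simp add: H_def blinfun.bilinear_simps p_def q_def r_def)
  qed
  moreover have "v - ((9/4) *\<^sub>R p - (3/2) *\<^sub>R q + (1/4) *\<^sub>R r)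
      = (3/4) *\<^sub>R (v - 2 *\<^sub>R p + q) + (1/4) *\<^sub>R (v - 3 *\<^sub>R p + 3 *\<^sub>R q - r)"
  proof -
    have "(3/4) *\<^sub>R v + (1/4) *\<^sub>R v = v" "(9/4) *\<^sub>R p = (3/2) *\<^sub>R p + (3/4) *\<^sub>R p"
      "(3/2) *\<^sub>R q = (3/4) *\<^sub>R q + (3/4) *\<^sub>R q"
      by (simp_all flip: scaleR_left_distrib)
    then show ?thesis
      by (simp add: scaleR_right_diff_distrib scaleR_right_distrib)
  qed
  ultimately show "(id_blinfun - (newton S T o\<^sub>L newton T S)) v
      = ((3/4) *\<^sub>R (H o\<^sub>L H) + (1/4) *\<^sub>R (H o\<^sub>L (H o\<^sub>L H))) v"
    by (simp add: blinfun.bilinear_simps)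
qed

text \<open>The coefficients 3/4 and 1/4 add up to 1, and for \<open>h \<le> 1\<close> the cubic
  term is bounded by \<open>h * h\<close> as well.\<close>

lemma norm_newton_defect_le:
  assumes "norm (id_blinfun - (S o\<^sub>L T)) \<le> h" "h \<le> 1"
  shows "norm (id_blinfun - (newton S T o\<^sub>L newton T S)) \<le> h * h"
proof -
  define H where "H = id_blinfun - (S o\<^sub>L T)"
  have H: "norm H \<le> h" "0 \<le> h"
    using assms(1) norm_ge_zero[of H] by (simp_all add: H_def order_trans[OF norm_ge_zero assms(1)])
  have 2: "norm (H o\<^sub>L H) \<le> h * h" by (intro norm_blinfun_compose_mono H)
  have "norm (H o\<^sub>L (H o\<^sub>L H)) \<le> 1 * (h * h)"
    by (intro norm_blinfun_compose_mono order_trans[OF H(1) assms(2)] H)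
  with 2 have "norm ((3/4) *\<^sub>R (H o\<^sub>L H) + (1/4) *\<^sub>R (H o\<^sub>L (H o\<^sub>L H))) \<le> 3/4 * (h * h) + 1/4 * (h * h)"
    by (intro norm_triangle_mono) simp_all
  then show ?thesis by (simp add: newton_defect H_def)
qed

lemma clinear_op_newton:
  assumes "clinear_op T" "clinear_op S"
  shows "clinear_op (newton T S)"
  using assms
  by (simp add: clinear_op_def newton_def blinfun.bilinear_simps
      linear_diff[OF bounded_linear.linear[OF bounded_linear_scaleC]]
      linear_scale[OF bounded_linear.linear[OF bounded_linear_scaleC]])

lemma adjoint_pair_newton:
  assumes "adjoint_pair T S"
  shows "adjoint_pair (newton T S) (newton S T)"
  using assms adjoint_pair_sym[OF assms]
  by (simp add: adjoint_pair_def newton_def blinfun.bilinear_simps rinner.diff_left rinner.diff_right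
      rinner.scaleR_left rinner.scaleR_right)

text \<open>Iterating on \<open>T\<close> and its adjoint \<open>S\<close> at once keeps them an
  adjoint pair. The limits are mutually inverse because both one-sided defects tend to 0, and the
  displacements \<open>\<eta>/2 * (1/2)^n\<close> sum to \<open>\<eta>\<close>.\<close>

lemma unitary_near_almost_unitary:
  fixes T S :: "'a::complex_hilbert_space \<Rightarrow>\<^sub>L 'a"
  assumes cl: "clinear_op T" "clinear_op S" and adj: "adjoint_pair T S"
    and le1: "norm T \<le> 1" "norm S \<le> 1" and \<eta>: "0 \<le> \<eta>" "\<eta> \<le> 1/4"
    and near: "norm (id_blinfun - (S o\<^sub>L T)) \<le> \<eta>" "norm (id_blinfun - (T o\<^sub>L S)) \<le> \<eta>"
  obtains U V where "unitary_pair U V" "norm (U - T) \<le> \<eta>"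
proof -
  define N where "N n = ((\<lambda>(T, S). (newton T S, newton S T)) ^^ n) (T, S)" for n
  define X Y where "X n = fst (N n)" and "Y n = snd (N n)" for n
  have X0: "X 0 = T" "Y 0 = S" by (simp_all add: X_def Y_def N_def)
  have XS: "X (Suc n) = newton (X n) (Y n)" "Y (Suc n) = newton (Y n) (X n)" for n
    by (simp_all add: X_def Y_def N_def case_prod_beta)
  have inv: "clinear_op (X n) \<and> clinear_op (Y n) \<and> adjoint_pair (X n) (Y n)" for n
    by (induction n) (simp_all add: X0 XS cl adj clinear_op_newton adjoint_pair_newton)
  \<comment> \<open>The defect is squared at each step; as it stays below
    \<open>\<eta> \<le> 1/4\<close>, it shrinks at least by the factor 1/4, which is all that is
    recorded.\<close>
  have defect: "norm (id_blinfun - (Y n o\<^sub>L X n)) \<le> \<eta> * (1/4)^n \<and> norm (id_blinfun - (X n o\<^sub>L Y n)) \<le> \<eta> * (1/4)^n" for n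
  proof (induction n)
    case 0
    then show ?case using near by (simp add: X0)
  next
    case (Suc n)
    define h where "h = \<eta> * (1/4)^n"
    have p: "(1/4::real)^n \<le> 1" by (simp add: power_le_one)
    have h: "0 \<le> h" "h \<le> 1/4"
      using \<eta> mult_mono[OF \<eta>(2) p] by (simp_all add: h_def)
    have "h * h \<le> \<eta> * (1/4) ^ Suc n"
      using mult_left_mono[OF h(2) h(1)] by (simp add: h_def)
    moreover have "norm (id_blinfun - (newton (Y n) (X n) o\<^sub>L newton (X n) (Y n))) \<le> h * h"
      "norm (id_blinfun - (newton (X n) (Y n) o\<^sub>L newton (Y n) (X n))) \<le> h * h"
      using Suc h by (auto intro!: norm_newton_defect_le simp: h_def)
    ultimately show ?case unfolding XS by (blast intro: order_trans)
  qed
  \<comment> \<open>The crude growth bound \<open>2^n\<close> for the iterates is beaten by the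
    defect rate \<open>(1/4)^n\<close>, leaving \<open>(1/2)^n\<close>.\<close>
  have step: "norm (newton A B - A) \<le> \<eta>/2 * (1/2)^n"
    if "norm A \<le> 2^n" "norm (id_blinfun - (B o\<^sub>L A)) \<le> \<eta> * (1/4)^n" for A B :: "'a \<Rightarrow>\<^sub>L 'a" and n
  proof -
    have "norm (newton A B - A) \<le> 1/2 * (2^n * (\<eta> * (1/4)^n))"
      using norm_blinfun_compose_mono[OF that] by (simp add: newton_diff)
    also have "\<dots> = \<eta>/2 * (2 * (1/4))^n"
      unfolding power_mult_distrib by simp
    finally show ?thesis by simp
  qed
  \<comment> \<open>Each displacement is at most 1, so a norm bound \<open>2^n\<close> grows to
    \<open>2^n + 1\<close>, which is at most \<open>2 ^ Suc n\<close>.\<close>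
  have small: "\<eta>/2 * (1/2)^n \<le> 1 * 1" for n
    using \<eta> by (intro mult_mono) (simp_all add: power_le_one)
  have grow: "norm (newton A B) \<le> 2 ^ Suc n"
    if "norm A \<le> 2^n" "norm (id_blinfun - (B o\<^sub>L A)) \<le> \<eta> * (1/4)^n" for A B :: "'a \<Rightarrow>\<^sub>L 'a" and n
  proof -
    have "norm (newton A B) \<le> norm A + norm (newton A B - A)"
      by (metis norm_triangle_sub)
    also have "\<dots> \<le> 2^n + 1" using step[OF that] small[of n] that(1) by linarith
    also have "\<dots> \<le> 2 ^ Suc n" by simp
    finally show ?thesis .
  qed
  have bound: "norm (X n) \<le> 2^n \<and> norm (Y n) \<le> 2^n" for n
  proof (induction n)
    case (Suc n)
    then show ?case unfolding XS using grow defect by blast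
  qed (use le1 in \<open>simp add: X0\<close>)
  have "norm (X (Suc n) - X n) \<le> \<eta>/2 * (1/2)^n" for n
    unfolding XS using step bound defect by blast
  then obtain U where U: "X \<longlonglongrightarrow> U" "norm (U - X 0) \<le> (\<eta>/2) / (1 - 1/2)"
    by (rule geometric_steps_limit) auto
  have "norm (Y (Suc n) - Y n) \<le> \<eta>/2 * (1/2)^n" for n
    unfolding XS using step bound defect by blast
  then obtain V where V: "Y \<longlonglongrightarrow> V"
    by (rule geometric_steps_limit) auto
  have null: "(\<lambda>n. \<eta> * (1/4::real)^n) \<longlonglongrightarrow> 0"
    by (intro tendsto_mult_right_zero LIMSEQ_power_zero) simp
  have inverse: "b o\<^sub>L a = id_blinfun"
    if lim: "A \<longlonglongrightarrow> a" "B \<longlonglongrightarrow> b" and le: "\<And>n. norm (id_blinfun - (B n o\<^sub>L A n)) \<le> \<eta> * (1/4)^n"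
    for A B :: "nat \<Rightarrow> 'a \<Rightarrow>\<^sub>L 'a" and a b
  proof -
    have "(\<lambda>n. id_blinfun - (B n o\<^sub>L A n)) \<longlonglongrightarrow> 0"
      by (rule Lim_null_comparison[OF _ null]) (simp add: le)
    moreover have "(\<lambda>n. id_blinfun - (B n o\<^sub>L A n)) \<longlonglongrightarrow> id_blinfun - (b o\<^sub>L a)"
      by (intro tendsto_intros blinfun_compose_tendsto lim)
    ultimately show ?thesis using LIMSEQ_unique by fastforce
  qed
  have "unitary_pair U V"
    unfolding unitary_pair_def
    using inverse[OF U(1) V] inverse[OF V U(1)] defect clinear_op_limit[OF U(1)] clinear_op_limit[OF V]
      adjoint_pair_limit[OF U(1) V] inv by blast
  then show thesis using that U(2) by (simp add: X0)
qed

section \<open>Almost representations, the improvement step and its iteration\<close>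

definition almost_rep ::
  "('g, 'b) monoid_scheme \<Rightarrow> 'g set \<Rightarrow> real \<Rightarrow> real \<Rightarrow> ('g \<Rightarrow> 'a::complex_hilbert_space \<Rightarrow>\<^sub>L 'a) \<Rightarrow> bool"
  where "almost_rep G \<Gamma> C e \<rho> \<longleftrightarrow>
    (\<forall>h\<in>carrier G. clinear_op (\<rho> h) \<and> norm (\<rho> h) \<le> C) \<and>
    (\<forall>x\<in>\<Gamma>. \<exists>V. unitary_pair (\<rho> x) V) \<and>
    (\<forall>x\<in>\<Gamma>. \<forall>h\<in>carrier G. norm (\<rho> (x \<otimes>\<^bsub>G\<^esub> h) - (\<rho> x o\<^sub>L \<rho> h)) \<le> e)"

lemma almost_rep_mono: "almost_rep G \<Gamma> C e \<rho> \<Longrightarrow> e \<le> e' \<Longrightarrow> almost_rep G \<Gamma> C e' \<rho>"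
  unfolding almost_rep_def by (meson order_trans)

text \<open>Invariance is on the right because the averages are transformed by substituting
  \<open>x \<otimes> y\<close> for the integration variable \<open>x\<close>.\<close>

locale invariant_mean = group G + bounded_mean \<Gamma> m
  for G :: "('g, 'b) monoid_scheme" (structure) and \<Gamma> :: "'g set" and m +
  assumes subgroup: "subgroup \<Gamma> G"
    and mean_translate: "\<And>f y. bounded (f ` \<Gamma>) \<Longrightarrow> y \<in> \<Gamma> \<Longrightarrow> m (\<lambda>x. f (x \<otimes> y)) = m f"
begin

lemma bounded_translate:
  assumes "bounded (F ` \<Gamma>)" "y \<in> \<Gamma>"
  shows "bounded ((\<lambda>x. F (x \<otimes> y)) ` \<Gamma>)"
  by (rule bounded_subset[OF assms(1)]) (use assms(2) subgroup.m_closed[OF subgroup] in auto)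

lemma omean_translate:
  assumes "bounded (F ` \<Gamma>)" "y \<in> \<Gamma>"
  shows "omean (\<lambda>x. F (x \<otimes> y)) = omean F"
proof (rule blinfun_eqI, rule rinner_ext)
  fix v w
  have "bounded ((\<lambda>x. rinner (F x v) w) ` \<Gamma>)"
    by (intro bounded_linear_comp_image[OF rinner.bounded_linear_left] bounded_apply assms)
  then show "rinner (omean (\<lambda>x. F (x \<otimes> y)) v) w = rinner (omean F v) w"
    using mean_translate[OF _ assms(2), of "\<lambda>x. rinner (F x v) w"]
    by (simp add: rinner_omean assms bounded_translate)
qed

text \<open>For \<open>y\<close> in \<open>\<Gamma>\<close> the integrand \<open>\<rho>(x)\<^sup>* \<rho>(x y h)\<close> of the average at \<open>y h\<close> is
  \<open>\<rho>(x)\<^sup>* \<rho>(x y) \<sqdot> \<rho>(x y)\<^sup>* \<rho>(x y h)\<close>, a product whose factors average to the values at \<open>y\<close>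
  and \<open>h\<close> and oscillate by \<open>e\<close>; so the new defect is quadratic in \<open>e\<close>.\<close>
lemma almost_rep_improve:
  fixes \<rho> :: "'g \<Rightarrow> 'h::complex_hilbert_space \<Rightarrow>\<^sub>L 'h"
  assumes rep: "almost_rep G \<Gamma> C e \<rho>" and C: "1 \<le> C" and e: "0 \<le> e" "e \<le> 1/10"
  obtains \<rho>' where "almost_rep G \<Gamma> C (8 * C * e\<^sup>2) \<rho>'"
    "\<And>h. h \<in> carrier G \<Longrightarrow> norm (\<rho>' h - \<rho> h) \<le> e + 2 * e\<^sup>2"
proof -
  have car: "x \<in> carrier G" if "x \<in> \<Gamma>" for x
    using subgroup.subset[OF subgroup] that by auto
  have mem: "x \<otimes> y \<in> \<Gamma>" "inv x \<in> \<Gamma>" if "x \<in> \<Gamma>" "y \<in> \<Gamma>" for x y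
    using that subgroup.m_closed[OF subgroup] subgroup.m_inv_closed[OF subgroup] by auto
  have \<rho>: "clinear_op (\<rho> h)" "norm (\<rho> h) \<le> C" if "h \<in> carrier G" for h
    using rep that by (auto simp: almost_rep_def)
  have defect: "norm (\<rho> (x \<otimes> h) - (\<rho> x o\<^sub>L \<rho> h)) \<le> e" if "x \<in> \<Gamma>" "h \<in> carrier G" for x h
    using rep that by (auto simp: almost_rep_def)
  obtain star where star: "\<And>x. x \<in> \<Gamma> \<Longrightarrow> unitary_pair (\<rho> x) (star x)"
    using rep unfolding almost_rep_def by metis
  note starD = star[unfolded unitary_pair_def]
  define F where "F h x = star x o\<^sub>L \<rho> (x \<otimes> h)" for h x
  define T where "T h = omean (F h)" for h
  have F_le: "norm (F h x) \<le> norm (\<rho> (x \<otimes> h))" if "x \<in> \<Gamma>" for x h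
    unfolding F_def by (rule norm_unitary_compose_le[OF unitary_pair_sym[OF star[OF that]]])
  have F_le_C: "norm (F h x) \<le> C" if "x \<in> \<Gamma>" "h \<in> carrier G" for x h
    using F_le[OF that(1), of h] \<rho>(2)[of "x \<otimes> h"] car that by simp
  have F_le_1: "norm (F h x) \<le> 1" if "x \<in> \<Gamma>" "h \<in> \<Gamma>" for x h
    using F_le[OF that(1), of h] norm_unitary_pair_le[OF star[OF mem(1)[OF that]]] by simp
  have F_bounded: "bounded (F h ` \<Gamma>)" if "h \<in> carrier G" for h
    using F_le_C that by (intro boundedI[of _ C]) auto
  \<comment> \<open>Since \<open>star x\<close> inverts \<open>\<rho> x\<close>, the difference is
    \<open>star x\<close> composed with the multiplicativity defect at \<open>x\<close> and
    \<open>h\<close>, and \<open>star x\<close> does not increase norms.\<close>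
  have F_near: "norm (F h x - \<rho> h) \<le> e" if "x \<in> \<Gamma>" "h \<in> carrier G" for x h
  proof -
    have "star x (\<rho> x v) = v" for v
      using starD[OF that(1)] by (metis blinfun_apply_blinfun_compose id_blinfun.rep_eq)
    then have "F h x - \<rho> h = star x o\<^sub>L (\<rho> (x \<otimes> h) - (\<rho> x o\<^sub>L \<rho> h))"
      by (intro blinfun_eqI) (simp add: F_def blinfun.bilinear_simps)
    then show ?thesis
      using norm_unitary_compose_le[OF unitary_pair_sym[OF star[OF that(1)]]] defect[OF that]
      by (metis order_trans)
  qed
  have T_near: "norm (T h - \<rho> h) \<le> e" if "h \<in> carrier G" for h
  proof -
    have "omean (\<lambda>x. F h x + (- \<rho> h)) = T h + (- \<rho> h)"
      unfolding T_def by (subst omean_add) (simp_all add: F_bounded that omean_const image_constant_conv)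
    moreover have "norm (omean (\<lambda>x. F h x + (- \<rho> h))) \<le> e"
      using F_near that e by (intro norm_omean_le) auto
    ultimately show ?thesis by simp
  qed
  have T_le_C: "norm (T h) \<le> C" if "h \<in> carrier G" for h
    unfolding T_def using F_le_C that C by (intro norm_omean_le) auto
  have T_le_1: "norm (T h) \<le> 1" if "h \<in> \<Gamma>" for h
    unfolding T_def using F_le_1 that by (intro norm_omean_le) auto
  have T_clinear: "clinear_op (T h)" if "h \<in> carrier G" for h
    unfolding clinear_op_def
  proof (intro allI)
    fix c v
    have "scaleC c (T h v) = vmean (\<lambda>x. scaleC c (F h x v))"
      unfolding T_def omean_apply[OF F_bounded[OF that]]
      by (rule vmean_linear[OF bounded_linear_scaleC bounded_apply[OF F_bounded[OF that]]])
    also have "\<dots> = vmean (\<lambda>x. F h x (scaleC c v))"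
      using starD \<rho>(1) car that by (intro vmean_cong) (simp add: F_def clinear_op_def)
    also have "\<dots> = T h (scaleC c v)"
      unfolding T_def omean_apply[OF F_bounded[OF that]] ..
    finally show "T h (scaleC c v) = scaleC c (T h v)" ..
  qed
  have T_adjoint: "adjoint_pair (T y) (T (inv y))" if y: "y \<in> \<Gamma>" for y
    unfolding adjoint_pair_def
  proof (intro allI)
    fix v w
    have iy: "inv y \<in> \<Gamma>" using mem(2) y by blast
    have b: "bounded ((\<lambda>x. rinner (F (inv y) x w) v) ` \<Gamma>)"
      by (intro bounded_linear_comp_image[OF rinner.bounded_linear_left] bounded_apply F_bounded car iy)
    have "rinner (T y v) w = m (\<lambda>x. rinner (F y x v) w)"
      unfolding T_def by (rule rinner_omean[OF F_bounded[OF car[OF y]]])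
    \<comment> \<open>The adjoint of \<open>star x o\<^sub>L \<rho> (x \<otimes> y)\<close> is
      \<open>star (x \<otimes> y) o\<^sub>L \<rho> x\<close>, which is the integrand for
      \<open>inv y\<close> evaluated at \<open>x \<otimes> y\<close>; right invariance then removes
      the shift.\<close>
    also have "\<dots> = m (\<lambda>x. rinner (F (inv y) (x \<otimes> y) w) v)"
    proof (rule mean_cong)
      fix x assume x: "x \<in> \<Gamma>"
      have "rinner (F y x v) w = rinner (\<rho> (x \<otimes> y) v) (\<rho> x w)"
        using adjoint_pair_sym[of "\<rho> x" "star x"] starD[OF x] by (simp add: F_def adjoint_pair_def)
      also have "\<dots> = rinner v (star (x \<otimes> y) (\<rho> x w))"
        using starD[OF mem(1)[OF x y]] by (simp add: adjoint_pair_def)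
      also have "\<dots> = rinner (F (inv y) (x \<otimes> y) w) v"
        using car x y by (simp add: F_def m_assoc rinner_commute)
      finally show "rinner (F y x v) w = rinner (F (inv y) (x \<otimes> y) w) v" .
    qed
    also have "\<dots> = m (\<lambda>x. rinner (F (inv y) x w) v)"
      by (rule mean_translate[OF b y])
    also have "\<dots> = rinner (T (inv y) w) v"
      unfolding T_def by (rule rinner_omean[OF F_bounded[OF car[OF iy]], symmetric])
    finally show "rinner (T y v) w = rinner v (T (inv y) w)"
      by (simp add: rinner_commute)
  qed
  have T_defect: "norm (T (y \<otimes> h) - (T y o\<^sub>L T h)) \<le> 2 * e\<^sup>2" if y: "y \<in> \<Gamma>" and h: "h \<in> carrier G" for y h
  proof -
    have "T (y \<otimes> h) = omean (\<lambda>x. F y x o\<^sub>L F h (x \<otimes> y))"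
      unfolding T_def
    proof (rule omean_cong, rule blinfun_eqI)
      fix x v assume x: "x \<in> \<Gamma>"
      have "\<rho> (x \<otimes> y) (star (x \<otimes> y) u) = u" for u
        using starD[OF mem(1)[OF x y]]
        by (metis blinfun_apply_blinfun_compose id_blinfun.rep_eq)
      then show "F (y \<otimes> h) x v = (F y x o\<^sub>L F h (x \<otimes> y)) v"
        using car x y h by (simp add: F_def m_assoc)
    qed
    moreover have "T h = omean (\<lambda>x. F h (x \<otimes> y))"
      unfolding T_def by (rule omean_translate[OF F_bounded[OF h] y, symmetric])
    moreover have "norm (omean (\<lambda>x. F y x o\<^sub>L F h (x \<otimes> y)) - (omean (F y) o\<^sub>L omean (\<lambda>x. F h (x \<otimes> y)))) \<le> 2 * e\<^sup>2"
      using F_near y h car mem e by (intro norm_omean_compose_le[of _ "\<rho> y" _ _ "\<rho> h"]) auto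
    ultimately show ?thesis by (simp add: T_def)
  qed
  \<comment> \<open>The average at the identity is exact, so the defects at the pairs
    \<open>inv y, y\<close> and \<open>y, inv y\<close> measure how far \<open>T (inv y)\<close> is
    from inverting \<open>T y\<close>.\<close>
  have T_one: "T \<one> = id_blinfun"
  proof -
    have "T \<one> = omean (\<lambda>x. id_blinfun)"
      unfolding T_def using starD car by (intro omean_cong) (simp add: F_def)
    then show ?thesis by (simp add: omean_const)
  qed
  have "\<exists>U V. unitary_pair U V \<and> norm (U - T y) \<le> 2 * e\<^sup>2" if y: "y \<in> \<Gamma>" for y
  proof -
    have iy: "inv y \<in> \<Gamma>" using mem(2) y by blast
    have "e\<^sup>2 \<le> (1/10)\<^sup>2" using e by (intro power_mono)
    then have "2 * e\<^sup>2 \<le> 1/4" by (simp add: power2_eq_square)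
    moreover have "norm (id_blinfun - (T (inv y) o\<^sub>L T y)) \<le> 2 * e\<^sup>2"
      "norm (id_blinfun - (T y o\<^sub>L T (inv y))) \<le> 2 * e\<^sup>2"
      using T_defect[OF iy car[OF y]] T_defect[OF y car[OF iy]] car[OF y] by (simp_all add: T_one)
    ultimately show ?thesis
      using unitary_near_almost_unitary[OF T_clinear[OF car[OF y]] T_clinear[OF car[OF iy]]
          T_adjoint[OF y] T_le_1[OF y] T_le_1[OF iy], of "2 * e\<^sup>2"] zero_le_power2[of e]
      by (metis mult_nonneg_nonneg zero_le_numeral)
  qed
  then obtain U V where U: "\<And>y. y \<in> \<Gamma> \<Longrightarrow> unitary_pair (U y) (V y)"
    "\<And>y. y \<in> \<Gamma> \<Longrightarrow> norm (U y - T y) \<le> 2 * e\<^sup>2" by metis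
  \<comment> \<open>The average already has a small defect; only on \<open>\<Gamma>\<close>, where
    unitarity is demanded, is it replaced, at a further cost of
    \<open>2 * e\<^sup>2\<close>.\<close>
  define \<rho>' where "\<rho>' h = (if h \<in> \<Gamma> then U h else T h)" for h
  have \<rho>'_T: "norm (\<rho>' h - T h) \<le> 2 * e\<^sup>2" for h
    using U(2) by (simp add: \<rho>'_def)
  have \<rho>'_le: "norm (\<rho>' h) \<le> C" if "h \<in> carrier G" for h
    using norm_unitary_pair_le[OF U(1)] T_le_C[OF that] C by (force simp: \<rho>'_def)
  have \<rho>'_clinear: "clinear_op (\<rho>' h)" if "h \<in> carrier G" for h
    using U(1) T_clinear[OF that] by (simp add: \<rho>'_def unitary_pair_def)
  have \<rho>'_defect: "norm (\<rho>' (x \<otimes> h) - (\<rho>' x o\<^sub>L \<rho>' h)) \<le> 8 * C * e\<^sup>2"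
    if x: "x \<in> \<Gamma>" and h: "h \<in> carrier G" for x h
  proof -
    have e2: "0 \<le> e\<^sup>2" "e\<^sup>2 \<le> C * e\<^sup>2" using C mult_right_mono[OF C, of "e\<^sup>2"] by simp_all
    interpret c: bounded_bilinear "(o\<^sub>L) :: ('h \<Rightarrow>\<^sub>L 'h) \<Rightarrow> _ \<Rightarrow> 'h \<Rightarrow>\<^sub>L 'h"
      by (rule bounded_bilinear_blinfun_compose)
    \<comment> \<open>The contributions are the replacement at \<open>x \<otimes> h\<close>, the
      defect of \<open>T\<close>, the replacement at \<open>h\<close> behind the contraction
      \<open>T x\<close>, and the replacement at \<open>x\<close> in front of
      \<open>\<rho>' h\<close>, whose norm is at most \<open>C\<close>. With
      \<open>1 \<le> C\<close> they total at most \<open>8 * C * e\<^sup>2\<close>.\<close>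
    have eq: "\<rho>' (x \<otimes> h) - (\<rho>' x o\<^sub>L \<rho>' h) = (\<rho>' (x \<otimes> h) - T (x \<otimes> h)) + (T (x \<otimes> h) - (T x o\<^sub>L T h))
        + (T x o\<^sub>L (T h - \<rho>' h)) + ((T x - \<rho>' x) o\<^sub>L \<rho>' h)"
      by (simp add: c.diff_left c.diff_right)
    have "norm (T x o\<^sub>L (T h - \<rho>' h)) \<le> 1 * (2 * e\<^sup>2)"
      using T_le_1[OF x] \<rho>'_T[of h] by (intro norm_blinfun_compose_mono) (simp_all add: norm_minus_commute)
    moreover have "norm ((T x - \<rho>' x) o\<^sub>L \<rho>' h) \<le> (2 * e\<^sup>2) * C"
      using \<rho>'_T[of x] \<rho>'_le[OF h] by (intro norm_blinfun_compose_mono) (simp_all add: norm_minus_commute)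
    ultimately have "norm (\<rho>' (x \<otimes> h) - (\<rho>' x o\<^sub>L \<rho>' h)) \<le> 2 * e\<^sup>2 + 2 * e\<^sup>2 + 1 * (2 * e\<^sup>2) + 2 * e\<^sup>2 * C"
      unfolding eq by (intro norm_triangle_mono \<rho>'_T T_defect x h)
    also have "\<dots> \<le> 8 * C * e\<^sup>2" using e2 by (simp add: algebra_simps)
    finally show ?thesis .
  qed
  have "almost_rep G \<Gamma> C (8 * C * e\<^sup>2) \<rho>'"
    unfolding almost_rep_def
  proof (intro conjI ballI)
    show "\<exists>V. unitary_pair (\<rho>' x) V" if "x \<in> \<Gamma>" for x
      using U(1)[OF that] that by (auto simp: \<rho>'_def)
  qed (use \<rho>'_le \<rho>'_clinear \<rho>'_defect in auto)
  moreover have "norm (\<rho>' h - \<rho> h) \<le> e + 2 * e\<^sup>2" if "h \<in> carrier G" for h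
    using norm_triangle_mono[OF \<rho>'_T[of h] T_near[OF that]] by simp
  ultimately show thesis by (rule that)
qed

text \<open>The first improvement is kept apart: it costs \<open>e + 2 * e\<^sup>2\<close>, while
  all later ones start from a defect \<open>a\<close> of order \<open>e\<^sup>2\<close> and cost
  \<open>6 * a = 48 * C * e\<^sup>2\<close> in total. Both fit the bound since
  \<open>2 + 48 * C \<le> 120 * C\<close>.\<close>

lemma almost_rep_near_exact:
  fixes \<rho> :: "'g \<Rightarrow> 'h::complex_hilbert_space \<Rightarrow>\<^sub>L 'h"
  assumes rep: "almost_rep G \<Gamma> C e \<rho>" and C: "1 \<le> C" and e: "0 < e" "e < 1 / (10 * C)"
  obtains \<sigma> where "almost_rep G \<Gamma> C 0 \<sigma>"
    "\<And>h. h \<in> carrier G \<Longrightarrow> norm (\<sigma> h - \<rho> h) \<le> e + 120 * C * e\<^sup>2"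
proof -
  define a where "a = 8 * C * e\<^sup>2"
  have Ce: "C * e < 1/10" using e C by (simp add: field_simps)
  have e10: "e < 1/10" using Ce mult_right_mono[OF C less_imp_le[OF e(1)]] by simp
  have a: "0 < a" "a \<le> e"
    using Ce C e mult_right_mono[of "8 * (C * e)" 1 e] by (simp_all add: a_def power2_eq_square)
  obtain \<rho>1 where \<rho>1: "almost_rep G \<Gamma> C a \<rho>1"
    "\<And>h. h \<in> carrier G \<Longrightarrow> norm (\<rho>1 h - \<rho> h) \<le> e + 2 * e\<^sup>2"
    using almost_rep_improve[OF rep C] e e10 unfolding a_def by (metis less_imp_le)
  \<comment> \<open>From a defect \<open>b \<le> e\<close> the next one is
    \<open>8 * C * b * b \<le> 4/5 * b\<close>, and the displacement
    \<open>b + 2 * b\<^sup>2\<close> is at most \<open>6/5 * b\<close> because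
    \<open>b < 1/10\<close>. The quadratic gain is traded for a geometric rate.\<close>
  have step: "\<exists>\<rho>'. almost_rep G \<Gamma> C (a * (4/5) ^ Suc n) \<rho>' \<and>
      (\<forall>h\<in>carrier G. norm (\<rho>' h - \<rho> h) \<le> 6/5 * a * (4/5) ^ n)"
    if rep: "almost_rep G \<Gamma> C (a * (4/5) ^ n) \<rho>" for n and \<rho> :: "'g \<Rightarrow> 'h \<Rightarrow>\<^sub>L 'h"
  proof -
    define b where "b = a * (4/5) ^ n"
    have "(4/5::real) ^ n \<le> 1" by (simp add: power_le_one)
    then have b: "0 < b" "b \<le> e"
      using a mult_left_mono[of "(4/5::real) ^ n" 1 a] unfolding b_def by (simp, linarith)
    have Cb: "8 * C * b \<le> 4/5"
      using mult_left_mono[OF b(2), of C] C Ce by linarith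
    obtain \<rho>' where \<rho>': "almost_rep G \<Gamma> C (8 * C * b\<^sup>2) \<rho>'"
      "\<And>h. h \<in> carrier G \<Longrightarrow> norm (\<rho>' h - \<rho> h) \<le> b + 2 * b\<^sup>2"
      by (rule almost_rep_improve[OF rep[folded b_def] C]) (use b e10 in auto)
    have "8 * C * b\<^sup>2 \<le> a * (4/5) ^ Suc n"
      using mult_right_mono[OF Cb less_imp_le[OF b(1)]] by (simp add: b_def power2_eq_square mult.assoc)
    moreover have "b + 2 * b\<^sup>2 \<le> 6/5 * a * (4/5) ^ n"
      using mult_right_mono[of b "1/10" b] b e10 by (simp add: b_def[symmetric] power2_eq_square mult.assoc)
    ultimately show ?thesis
      using almost_rep_mono[OF \<rho>'(1)] \<rho>'(2) by (meson order_trans)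
  qed
  obtain R where R0: "R 0 = \<rho>1"
    and R: "\<And>n. almost_rep G \<Gamma> C (a * (4/5) ^ n) (R n)"
    and RS: "\<And>n h. h \<in> carrier G \<Longrightarrow> norm (R (Suc n) h - R n h) \<le> 6/5 * a * (4/5) ^ n"
  proof -
    \<comment> \<open>The clause for \<open>n = 0\<close> pins the chosen sequence to start at
      \<open>\<rho>1\<close>.\<close>
    have "\<exists>R. \<forall>n. (almost_rep G \<Gamma> C (a * (4/5) ^ n) (R n) \<and> (n = 0 \<longrightarrow> R n = \<rho>1)) \<and>
        (\<forall>h\<in>carrier G. norm (R (Suc n) h - R n h) \<le> 6/5 * a * (4/5) ^ n)"
      by (rule dependent_nat_choice) (use \<rho>1(1) step in auto)
    then show thesis using that by blast
  qed
  have "\<exists>l. (\<lambda>n. R n h) \<longlonglongrightarrow> l \<and> norm (l - \<rho>1 h) \<le> 6 * a" if h: "h \<in> carrier G" for h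
  proof -
    \<comment> \<open>The geometric sum \<open>(6/5 * a) / (1 - 4/5)\<close> equals
      \<open>6 * a\<close>.\<close>
    obtain l where "(\<lambda>n. R n h) \<longlonglongrightarrow> l" "norm (l - R 0 h) \<le> (6/5 * a) / (1 - 4/5)"
      by (rule geometric_steps_limit[OF RS[OF h]]) auto
    then show ?thesis by (auto simp: R0)
  qed
  then obtain \<sigma> where \<sigma>: "\<And>h. h \<in> carrier G \<Longrightarrow> (\<lambda>n. R n h) \<longlonglongrightarrow> \<sigma> h"
    "\<And>h. h \<in> carrier G \<Longrightarrow> norm (\<sigma> h - \<rho>1 h) \<le> 6 * a" by metis
  have car: "x \<in> carrier G" if "x \<in> \<Gamma>" for x
    using subgroup.subset[OF subgroup] that by auto
  have null: "(\<lambda>n. a * (4/5::real) ^ n) \<longlonglongrightarrow> 0"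
    by (intro tendsto_mult_right_zero LIMSEQ_power_zero) simp
  \<comment> \<open>Exact multiplicativity takes the form of a defect of norm at most 0, the limit
    of the bounds for the \<open>R n\<close>.\<close>
  have mult: "norm (\<sigma> (x \<otimes> h) - (\<sigma> x o\<^sub>L \<sigma> h)) \<le> 0" if "x \<in> \<Gamma>" "h \<in> carrier G" for x h
  proof (rule LIMSEQ_le[OF _ null])
    show "(\<lambda>n. norm (R n (x \<otimes> h) - (R n x o\<^sub>L R n h))) \<longlonglongrightarrow> norm (\<sigma> (x \<otimes> h) - (\<sigma> x o\<^sub>L \<sigma> h))"
      using that car by (intro tendsto_intros blinfun_compose_tendsto \<sigma>) auto
    show "\<exists>N. \<forall>n\<ge>N. norm (R n (x \<otimes> h) - (R n x o\<^sub>L R n h)) \<le> a * (4/5) ^ n"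
      using R that by (auto simp: almost_rep_def)
  qed
  have unitary: "\<exists>V. unitary_pair (\<sigma> x) V" if x: "x \<in> \<Gamma>" for x
    by (rule unitary_pair_limit[OF \<sigma>(1)[OF car[OF x]]]) (use R x in \<open>auto simp: almost_rep_def\<close>)
  have "almost_rep G \<Gamma> C 0 \<sigma>"
    unfolding almost_rep_def
  proof (intro conjI ballI)
    fix h assume h: "h \<in> carrier G"
    show "clinear_op (\<sigma> h)"
      by (rule clinear_op_limit[OF \<sigma>(1)[OF h]]) (use R h in \<open>auto simp: almost_rep_def\<close>)
    show "norm (\<sigma> h) \<le> C"
      by (rule LIMSEQ_le_const2[OF tendsto_norm[OF \<sigma>(1)[OF h]]]) (use R h in \<open>auto simp: almost_rep_def\<close>)
  qed (use mult unitary in blast)+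
  moreover have "norm (\<sigma> h - \<rho> h) \<le> e + 120 * C * e\<^sup>2" if "h \<in> carrier G" for h
  proof -
    have "norm (\<sigma> h - \<rho> h) \<le> 6 * a + (e + 2 * e\<^sup>2)"
      using norm_triangle_mono[OF \<sigma>(2)[OF that] \<rho>1(2)[OF that]] by simp
    also have "\<dots> \<le> e + 120 * C * e\<^sup>2"
    proof -
      have "e\<^sup>2 \<le> C * e\<^sup>2" "0 \<le> e\<^sup>2" using mult_right_mono[OF C, of "e\<^sup>2"] by simp_all
      then show ?thesis unfolding a_def by linarith
    qed
    finally show ?thesis .
  qed
  ultimately show thesis by (rule that)
qed

end

section \<open>From amenability to a right-invariant mean\<close>

text \<open>Inversion turns the left-invariant mean into a right-invariant one.\<close>
lemma amenable_subgroup_invariant_mean: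
  assumes "group G" "amenable_subgroup G \<Gamma>"
  obtains m where "invariant_mean G \<Gamma> m"
proof -
  interpret group G by fact
  have sub: "subgroup \<Gamma> G" using assms(2) by (simp add: amenable_subgroup_def)
  have car: "x \<in> carrier G" if "x \<in> \<Gamma>" for x
    using subgroup.subset[OF sub] that by auto
  have inv: "inv\<^bsub>G\<^esub> x \<in> \<Gamma>" if "x \<in> \<Gamma>" for x
    using subgroup.m_inv_closed[OF sub that] .
  obtain m where M:
    "\<forall>f g. (\<forall>x\<in>\<Gamma>. f x = g x) \<longrightarrow> m f = m g"
    "\<forall>f g. bounded (f ` \<Gamma>) \<longrightarrow> bounded (g ` \<Gamma>) \<longrightarrow> m (\<lambda>x. f x + g x) = m f + m g"
    "\<forall>c f. bounded (f ` \<Gamma>) \<longrightarrow> m (\<lambda>x. c * f x) = c * m f"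
    "\<forall>f. bounded (f ` \<Gamma>) \<longrightarrow> (\<forall>x\<in>\<Gamma>. 0 \<le> f x) \<longrightarrow> 0 \<le> m f"
    "m (\<lambda>x. 1) = (1::real)"
    "\<forall>f y. bounded (f ` \<Gamma>) \<longrightarrow> y \<in> \<Gamma> \<longrightarrow> m (\<lambda>x. f (y \<otimes>\<^bsub>G\<^esub> x)) = m f"
    using assms(2) unfolding amenable_subgroup_def by (elim conjE exE)
  note m = M[rule_format]
  have bdd: "bounded ((\<lambda>x. f (inv\<^bsub>G\<^esub> x)) ` \<Gamma>)" if "bounded (f ` \<Gamma>)" for f :: "'a \<Rightarrow> real"
    by (rule bounded_subset[OF that]) (use inv in auto)
  have "invariant_mean G \<Gamma> (\<lambda>f. m (\<lambda>x. f (inv\<^bsub>G\<^esub> x)))"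
  proof (intro invariant_mean.intro bounded_mean.intro invariant_mean_axioms.intro)
    fix f :: "'a \<Rightarrow> real" and y
    assume f: "bounded (f ` \<Gamma>)" and y: "y \<in> \<Gamma>"
    \<comment> \<open>As \<open>inv x \<otimes> y = inv (inv y \<otimes> x)\<close>, right
      translation by \<open>y\<close> turns into left translation by \<open>inv y\<close>.\<close>
    have "m (\<lambda>x. f (inv\<^bsub>G\<^esub> x \<otimes>\<^bsub>G\<^esub> y)) = m (\<lambda>x. f (inv\<^bsub>G\<^esub> (inv\<^bsub>G\<^esub> y \<otimes>\<^bsub>G\<^esub> x)))"
      using car y by (intro m(1)) (simp add: inv_mult_group)
    also have "\<dots> = m (\<lambda>x. f (inv\<^bsub>G\<^esub> x))"
      by (rule m(6)[OF bdd[OF f] inv[OF y]])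
    finally show "m (\<lambda>x. f (inv\<^bsub>G\<^esub> x \<otimes>\<^bsub>G\<^esub> y)) = m (\<lambda>x. f (inv\<^bsub>G\<^esub> x))" .
  qed (auto intro!: assms(1) sub m inv bdd)
  then show thesis by (rule that)
qed

section \<open>Transfer between operators as functions and as bounded linear maps\<close>

lemma bounded_op_iff_clinear: "bounded_op (blinfun_apply T) \<longleftrightarrow> clinear_op T"
  by (simp add: bounded_op_def clinear_op_def blinfun.bounded_linear_right)

text \<open>The form is conjugate-linear in its first argument, so the real part of
  \<open>cinner (scaleC \<i> x) y\<close> is the imaginary part of
  \<open>cinner x y\<close>.\<close>

lemma cinner_eq_rinner:
  "cinner x y = Complex (rinner x y) (rinner (scaleC \<i> x) y)"
  by (simp add: rinner_def cinner_scaleC_left complex_eq_iff)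

lemma unitary_op_iff_pair: "unitary_op (blinfun_apply U) \<longleftrightarrow> (\<exists>V. unitary_pair U V)"
proof
  assume "unitary_op (blinfun_apply U)"
  then obtain V where V: "bounded_op V" "\<And>x y. cinner (U x) y = cinner x (V y)"
    "V \<circ> blinfun_apply U = id" "blinfun_apply U \<circ> V = id" and U: "clinear_op U"
    by (auto simp: unitary_op_def bounded_op_iff_clinear)
  have app: "blinfun_apply (Blinfun V) = V"
    using V(1) by (simp add: bounded_op_def bounded_linear_Blinfun_apply)
  have "unitary_pair U (Blinfun V)"
    unfolding unitary_pair_def
  proof (intro conjI)
    show "clinear_op (Blinfun V)" using V(1) by (simp add: app flip: bounded_op_iff_clinear)
    show "adjoint_pair U (Blinfun V)" using V(2) by (simp add: adjoint_pair_def rinner_def app)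
    show "Blinfun V o\<^sub>L U = id_blinfun" "U o\<^sub>L Blinfun V = id_blinfun"
      using V(3,4) by (auto intro!: blinfun_eqI simp: app fun_eq_iff)
  qed (rule U)
  then show "\<exists>V. unitary_pair U V" ..
next
  assume "\<exists>V. unitary_pair U V"
  then obtain V where V: "unitary_pair U V" ..
  have "V o\<^sub>L U = id_blinfun" "U o\<^sub>L V = id_blinfun"
    using V by (simp_all add: unitary_pair_def)
  then have "blinfun_apply V \<circ> blinfun_apply U = id" "blinfun_apply U \<circ> blinfun_apply V = id"
    by (metis blinfun_compose.rep_eq id_blinfun.rep_eq eq_id_iff)+
  \<comment> \<open>The real adjoint relation at \<open>x\<close> and at
    \<open>scaleC \<i> x\<close>, the latter moved through \<open>U\<close> by complex linearity,
    gives both components.\<close>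
  moreover have "cinner (U x) y = cinner x (V y)" for x y
    using V unfolding cinner_eq_rinner unitary_pair_def adjoint_pair_def clinear_op_def by metis
  ultimately show "unitary_op (blinfun_apply U)"
    using V unfolding unitary_op_def bounded_op_iff_clinear unitary_pair_def
    by (intro conjI exI[of _ "blinfun_apply V"]) (simp_all add: bounded_op_iff_clinear)
qed

theorem theorem2p2:
  fixes G :: "('g, 'b) monoid_scheme" (structure)
    and \<Gamma> :: "'g set"
    and C \<epsilon> :: real
    and \<pi> :: "'g \<Rightarrow> ('a::complex_hilbert_space \<Rightarrow> 'a)"
  assumes "group G"
    and "amenable_subgroup G \<Gamma>"
    and "C \<ge> 1" and "0 < \<epsilon>" and "\<epsilon> < 1 / (10 * C)"
    and "\<forall>h\<in>carrier G. bounded_op (\<pi> h)"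
    and "\<pi> \<one> = id"
    and "\<forall>x\<in>\<Gamma>. unitary_op (\<pi> x)"
    and "\<forall>h\<in>carrier G. onorm (\<pi> h) \<le> C"
    and "\<forall>x\<in>\<Gamma>. \<forall>h\<in>carrier G. onorm (\<lambda>v. \<pi> (x \<otimes> h) v - \<pi> x (\<pi> h v)) \<le> \<epsilon>"
  shows "\<exists>\<sigma> :: 'g \<Rightarrow> ('a \<Rightarrow> 'a).
           (\<forall>h\<in>carrier G. bounded_op (\<sigma> h)) \<and>
           (\<forall>h\<in>carrier G. onorm (\<lambda>v. \<sigma> h v - \<pi> h v) \<le> \<epsilon> + 120 * C * \<epsilon>\<^sup>2) \<and>
           (\<forall>x\<in>\<Gamma>. unitary_op (\<sigma> x)) \<and>
           (\<forall>h\<in>carrier G. onorm (\<sigma> h) \<le> C) \<and>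
           (\<forall>x\<in>\<Gamma>. \<forall>h\<in>carrier G. \<sigma> (x \<otimes> h) = \<sigma> x \<circ> \<sigma> h)"
proof -
  define \<rho> where "\<rho> h = Blinfun (\<pi> h)" for h
  \<comment> \<open>Boundedness of \<open>\<pi> h\<close> is assumed only for \<open>h\<close> in
    the carrier, hence the restriction.\<close>
  have app: "blinfun_apply (\<rho> h) = \<pi> h" if "h \<in> carrier G" for h
    using assms(6) that by (simp add: \<rho>_def bounded_op_def bounded_linear_Blinfun_apply)
  interpret group G by fact
  have sub: "subgroup \<Gamma> G" using assms(2) by (simp add: amenable_subgroup_def)
  have car: "x \<in> carrier G" if "x \<in> \<Gamma>" for x
    using subgroup.subset[OF sub] that by auto
  have "almost_rep G \<Gamma> C \<epsilon> \<rho>"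
    unfolding almost_rep_def
  proof (intro conjI ballI)
    show "clinear_op (\<rho> h)" "norm (\<rho> h) \<le> C" if "h \<in> carrier G" for h
      using assms(6,9) that by (simp_all add: app norm_blinfun.rep_eq flip: bounded_op_iff_clinear)
    show "\<exists>V. unitary_pair (\<rho> x) V" if "x \<in> \<Gamma>" for x
      using assms(8) that by (simp add: app car flip: unitary_op_iff_pair)
    show "norm (\<rho> (x \<otimes> h) - (\<rho> x o\<^sub>L \<rho> h)) \<le> \<epsilon>" if "x \<in> \<Gamma>" "h \<in> carrier G" for x h
      using assms(10) that by (simp add: norm_blinfun.rep_eq minus_blinfun.rep_eq app car)
  qed
  moreover obtain m where "invariant_mean G \<Gamma> m"
    using amenable_subgroup_invariant_mean[OF assms(1,2)] .
  ultimately obtain \<tau> where \<tau>: "almost_rep G \<Gamma> C 0 \<tau>"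
    "\<And>h. h \<in> carrier G \<Longrightarrow> norm (\<tau> h - \<rho> h) \<le> \<epsilon> + 120 * C * \<epsilon>\<^sup>2"
    using invariant_mean.almost_rep_near_exact[OF _ _ assms(3,4,5)] by blast
  show ?thesis
  proof (intro exI[of _ "\<lambda>h. blinfun_apply (\<tau> h)"] conjI ballI)
    show "bounded_op (\<tau> h)" "onorm (\<tau> h) \<le> C" if "h \<in> carrier G" for h
      using \<tau>(1) that by (simp_all add: almost_rep_def bounded_op_iff_clinear norm_blinfun.rep_eq)
    show "onorm (\<lambda>v. \<tau> h v - \<pi> h v) \<le> \<epsilon> + 120 * C * \<epsilon>\<^sup>2" if "h \<in> carrier G" for h
      using \<tau>(2)[OF that] by (simp add: norm_blinfun.rep_eq minus_blinfun.rep_eq app that)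
    show "unitary_op (\<tau> x)" if "x \<in> \<Gamma>" for x
      using \<tau>(1) that by (simp add: almost_rep_def unitary_op_iff_pair)
    show "blinfun_apply (\<tau> (x \<otimes> h)) = \<tau> x \<circ> \<tau> h" if "x \<in> \<Gamma>" "h \<in> carrier G" for x h
      using \<tau>(1) that by (simp add: almost_rep_def blinfun_compose.rep_eq)
  qed
qed

end
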